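(* Let $p_2$ and $p_3$ be primes with $3<p_2<p_3$, $p_2\equiv 2 \pmod 3$ and $p_3>3p_2$. Let $r_3$ be the remainder of $p_3$ upon division by $3p_2$, and put $N=\frac{(p_2+1)(7p_2-2)}{9p_2}$. Then \[\mathrm{hw}(\Phi_{3p_2p_3})=\begin{cases} N(p_3-2)+\frac{4p_2+1}{3}, & \text{if } r_3=2,\\ N(p_3+2)-\frac{4p_2+1}{3}, & \text{if } r_3=3p_2-2.\end{cases}\]
   Context: $\Phi_n$ denotes the $n$-th cyclotomic polynomial. For a polynomial $f$, $\mathrm{hw}(f)$ (Hamming weight) denotes the number of nonzero terms (nonzero coefficients) of $f$. *)

theory Defs
  imports Complex_Main "HOL-Computational_Algebra.Computational_Algebra"
begin

definition primitive_root_of_unity :: "nat \<Rightarrow> complex \<Rightarrow> bool" where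
  "primitive_root_of_unity n z \<longleftrightarrow> z ^ n = 1 \<and> (\<forall>k. 0 < k \<and> k < n \<longrightarrow> z ^ k \<noteq> 1)"

text \<open>
  The cyclotomic polynomial is taken over the complex numbers. Its coefficients are integers, and
  the number of nonzero coefficients does not depend on the coefficient ring of characteristic 0.
  Only \<^term>\<open>n > 0\<close> is meaningful; for \<^term>\<open>n = 0\<close> the index set is infinite and the product is 1.
\<close>

definition cyclotomic_poly :: "nat \<Rightarrow> complex poly" where
  "cyclotomic_poly n = (\<Prod>z | primitive_root_of_unity n z. [:- z, 1:])"

definition hw :: "'a::zero poly \<Rightarrow> nat" where
  "hw f = card {i. coeff f i \<noteq> 0}"

end

theory Submission
  imports Defs
begin

text \<open>
  Write \<open>p, q\<close> for \<open>p\<^sub>2, p\<^sub>3\<close> and \<open>p = 6s + 5\<close>. Since \<open>1 / \<Phi>\<^sub>3\<^sub>p\<close> has \<open>3p\<close>-periodic coefficients \<open>c\<close>, the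
  coefficient of \<open>x^m\<close> in \<open>\<Phi>\<^sub>3\<^sub>p\<^sub>q = \<Phi>\<^sub>3\<^sub>p(x^q) / \<Phi>\<^sub>3\<^sub>p(x)\<close> is \<open>B t m = \<Sum>j\<le>t. a j * c (m - q j)\<close> with
  \<open>t = m div q\<close>, where \<open>a\<close> are the coefficients of \<open>\<Phi>\<^sub>3\<^sub>p\<close>. If \<open>q = 3pk \<plusminus> 2\<close>, then row \<open>t\<close> consists of \<open>k\<close> full
  periods of \<open>B t\<close>, plus or minus two entries. Because \<open>\<Phi>\<^sub>3\<^sub>p(x\<^sup>2) = \<Phi>\<^sub>3\<^sub>p(x) \<Phi>\<^sub>3\<^sub>p(-x)\<close>, these extra entries
  are, up to sign, the coefficients of \<open>\<Phi>\<^sub>3\<^sub>p\<close> itself, of which \<open>(4p + 1) / 3\<close> are nonzero. The number of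
  nonzero entries in a period of \<open>B t\<close> is invariant under \<open>t \<mapsto> 2p - 3 - t\<close>; for \<open>t \<le> p - 2\<close> the
  substitution \<open>m = 2x\<close> makes \<open>B t\<close> a combination of six shifts of the truncation of \<open>a\<close> at \<open>t\<close>, whose
  overlaps depend only on residues modulo 3.
\<close>

section \<open>The power series of the inverse cyclotomic polynomial\<close>

(* This simproc would turn equations between power series into equations between polynomials. *)
declare [[simproc del: poly_fps_eq]]

text \<open>For \<open>p mod 3 = 2\<close>, \<open>phi_coeff p\<close> are the coefficients of \<open>\<Phi>\<^sub>3\<^sub>p\<close>, and \<open>inv_coeff p\<close> is the
  \<open>3p\<close>-periodic extension to the integers of the coefficients of \<open>1 / \<Phi>\<^sub>3\<^sub>p\<close>. The coefficient of
  \<open>x^m\<close> in \<open>\<Phi>\<^sub>3\<^sub>p\<^sub>q = \<Phi>\<^sub>3\<^sub>p(x^q) / \<Phi>\<^sub>3\<^sub>p(x)\<close> is \<open>partial_conv p q (m div q) m\<close>.\<close>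

definition phi_coeff :: "nat \<Rightarrow> nat \<Rightarrow> int" where
  "phi_coeff p j =
     (if j < p then (if j mod 3 = 0 then 1 else if j mod 3 = 1 then -1 else 0)
      else if j < 2 * p - 1 then (if j mod 3 = 2 then 1 else if j mod 3 = 1 then -1 else 0)
      else 0)"

definition inv_coeff :: "nat \<Rightarrow> int \<Rightarrow> int" where
  "inv_coeff p r =
     (if r mod (3 * int p) \<in> {0, 1, 2} then 1
      else if r mod (3 * int p) \<in> {int p, int p + 1, int p + 2} then -1 else 0)"

definition partial_conv :: "nat \<Rightarrow> int \<Rightarrow> nat \<Rightarrow> int \<Rightarrow> int" where
  "partial_conv p e t r = (\<Sum>j\<le>t. phi_coeff p j * inv_coeff p (r - e * int j))"

text \<open>Evaluating at a ring element instead of forming a polynomial lets \<open>X\<close>,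
  \<open>-X\<close>, \<open>X^2\<close> and \<open>X^q\<close> be substituted within one ring of
  power series.\<close>

definition phi_eval :: "nat \<Rightarrow> 'a::comm_ring_1 \<Rightarrow> 'a" where
  "phi_eval p y = (\<Sum>j<2 * p - 1. of_int (phi_coeff p j) * y ^ j)"

section \<open>Product formulas for Phi_3p\<close>

lemma geom_cubes: "(1 - y ^ 3) * (\<Sum>i<m. y ^ (3 * i)) = 1 - (y::'a::comm_ring_1) ^ (3 * m)"
  by (simp only: power_mult one_diff_power_eq)

lemma sum_lessThan_triple:
  fixes f :: "nat \<Rightarrow> 'a::comm_monoid_add"
  shows "(\<Sum>i<3 * m. f i) = (\<Sum>i<m. f (3 * i) + f (3 * i + 1) + f (3 * i + 2))"
  by (induction m) (simp_all add: algebra_simps eval_nat_numeral)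

lemma quartic_factor: "(1 + z + z ^ 2) * (1 - z + z ^ 2) = 1 + z ^ 2 + (z::'a::comm_ring_1) ^ 4"
  by (simp add: algebra_simps eval_nat_numeral)

lemma mod_triple: "Suc (3 * i) mod 3 = 1" "Suc (Suc (3 * i)) mod 3 = 2" "(3 * i + 2) mod 3 = 2" for i :: nat
  by presburger+

lemma phi_eval_low:
  assumes "p = 3 * u + 2"
  shows "(\<Sum>j<p. of_int (phi_coeff p j) * y ^ j) = (1 - y) * (\<Sum>i<Suc u. (y::'a::comm_ring_1) ^ (3 * i))"
proof -
  have "(\<Sum>j<p. of_int (phi_coeff p j) * y ^ j)
    = (\<Sum>j<3 * Suc u. of_int (if j mod 3 = 0 then 1 else if j mod 3 = 1 then -1 else 0) * y ^ j)"
  proof -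
    have m: "3 * Suc u = Suc p" "p mod 3 = 2" using assms by presburger+
    show ?thesis unfolding m(1) sum.lessThan_Suc m(2)
      by (simp add: phi_coeff_def)
  qed
  also have "\<dots> = (\<Sum>i<Suc u. y ^ (3 * i) - y ^ (3 * i + 1))"
    unfolding sum_lessThan_triple by (simp add: mod_triple)
  also have "\<dots> = (1 - y) * (\<Sum>i<Suc u. y ^ (3 * i))"
    unfolding sum_distrib_left by (simp add: left_diff_distrib)
  finally show ?thesis .
qed

lemma phi_eval_high:
  assumes "p = 3 * u + 2"
  shows "(\<Sum>j=p..<2*p-1. of_int (phi_coeff p j) * y ^ j)
         = y ^ p * (1 - (1 - y) * y ^ 2 * (\<Sum>i<u. (y::'a::comm_ring_1) ^ (3 * i)))"
proof -
  have "(\<Sum>j=p..<2*p-1. of_int (phi_coeff p j) * y ^ j) = (\<Sum>j<Suc (3 * u). of_int (phi_coeff p (j + p)) * y ^ (j + p))"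
    using sum.shift_bounds_nat_ivl[of "\<lambda>j. of_int (phi_coeff p j) * y ^ j" 0 p "Suc (3 * u)"] assms
    by (simp add: atLeast0LessThan)
  \<comment> \<open>The term \<open>j = p\<close> is split off because the rest starts at
    \<open>p + 1\<close>, a multiple of 3, so residues can be read off the shifted index.\<close>
  also have "\<dots> = y ^ p + (\<Sum>j<3*u. of_int (phi_coeff p (Suc j + p)) * y ^ (Suc j + p))"
  proof -
    have "phi_coeff p (0 + p) = 1" using assms unfolding phi_coeff_def by (simp; presburger)
    then show ?thesis unfolding sum.lessThan_Suc_shift by simp
  qed
  also have "(\<Sum>j<3*u. of_int (phi_coeff p (Suc j + p)) * y ^ (Suc j + p)) 
     = (\<Sum>j<3*u. of_int (if j mod 3 = 1 then -1 else if j mod 3 = 2 then 1 else 0) * y ^ (Suc j + p))"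
  proof (intro sum.cong refl)
    fix j assume "j \<in> {..<3*u}"
    then have "phi_coeff p (Suc j + p) = (if j mod 3 = 1 then -1 else if j mod 3 = 2 then 1 else 0)"
      unfolding phi_coeff_def using assms by (auto; presburger)
    then show "of_int (phi_coeff p (Suc j + p)) * y ^ (Suc j + p) = 
      of_int (if j mod 3 = 1 then -1 else if j mod 3 = 2 then 1 else 0) * y ^ (Suc j + p)" by simp
  qed
  also have "\<dots> = (\<Sum>i<u. y ^ Suc (Suc (Suc (3 * i + p))) - y ^ Suc (Suc (3 * i + p)))"
    unfolding sum_lessThan_triple by (simp add: mod_triple add_ac)
  also have "y ^ p + \<dots> = y ^ p * (1 - (1 - y) * y ^ 2 * (\<Sum>i<u. y ^ (3 * i)))"
    by (simp add: sum_distrib_left sum_subtractf left_diff_distrib right_diff_distrib power_add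
      power2_eq_square power3_eq_cube mult_ac)
  finally show ?thesis .
qed

text \<open>This is Phi_3p(y) Phi_3(y) = Phi_3(y^p). The factor \<open>1 + y + y^2\<close> turns
  \<open>1 - y\<close> into \<open>1 - y^3\<close>, against which both geometric sums in
  \<open>y^3\<close> telescope.\<close>

lemma phi_eval_mult:
  assumes "p = 3 * u + 2"
  shows "phi_eval p y * (1 + y + y ^ 2) = 1 + (y::'a::comm_ring_1) ^ p + y ^ (2 * p)"
proof -
  have split: "phi_eval p y = (1 - y) * (\<Sum>i<Suc u. y ^ (3 * i))
      + y ^ p * (1 - (1 - y) * y ^ 2 * (\<Sum>i<u. y ^ (3 * i)))"
  proof -
    have "{..<2*p-1} = {..<p} \<union> {p..<2*p-1}" using assms by auto
    then have "phi_eval p y = (\<Sum>j<p. of_int (phi_coeff p j) * y ^ j) + (\<Sum>j=p..<2*p-1. of_int (phi_coeff p j) * y ^ j)"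
      unfolding phi_eval_def by (simp add: sum.union_disjoint Int_def)
    then show ?thesis using assms by (simp only: phi_eval_low phi_eval_high)
  qed
  define S where "S m = (\<Sum>i<m. y ^ (3 * i))" for m
  have S: "(1 - y ^ 3) * S m = 1 - y ^ (3 * m)" for m
    unfolding S_def by (rule geom_cubes)
  have "phi_eval p y * (1 + y + y ^ 2)
     = (1 - y ^ 3) * S (Suc u) + y ^ p * (1 + y + y ^ 2 - y ^ 2 * ((1 - y ^ 3) * S u))"
  proof -
    have c: "1 - y ^ 3 = (1 - y) * (1 + y + y ^ 2)"
      by (simp add: algebra_simps eval_nat_numeral)
    show ?thesis unfolding split S_def[symmetric] c by (simp only: algebra_simps mult_1_left)
  qed
  also have "\<dots> = 1 - y ^ (3 * Suc u) + y ^ p * (1 + y + y ^ (3 * u + 2))"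
    unfolding S by (simp add: algebra_simps power_add power2_eq_square)
  also have "\<dots> = 1 + y ^ p + y ^ (2 * p)"
  proof -
    have e: "3 * Suc u = Suc p" "3 * u + 2 = p" using assms by simp_all
    show ?thesis unfolding e by (simp add: algebra_simps flip: power_add mult_2)
  qed
  finally show ?thesis .
qed

text \<open>By \<open>phi_eval_mult\<close> both sides are quotients of values of Phi_3, and
  \<open>quartic_factor\<close> says Phi_3(z^2) = Phi_3(z) Phi_3(-z). This is used at
  \<open>X\<close> and at \<open>X^p\<close>; since \<open>p\<close> is odd,
  \<open>(-X)^p = -X^p\<close>.\<close>

lemma phi_eval_square:
  assumes "p = 6 * s + 5"
  shows "phi_eval p ((fps_X :: 'a::idom fps) ^ 2) = phi_eval p fps_X * phi_eval p (- fps_X)"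
proof -
  have u: "p = 3 * (2 * s + 1) + 2" using assms by simp
  have odd: "odd p" using assms by simp
  let ?X = "fps_X :: 'a fps"
  let ?K = "1 + ?X ^ 2 + ?X ^ 4"
  have "fps_nth ?K 0 \<noteq> 0"
    by (simp add: fps_X_power_nth)
  then have nz: "?K \<noteq> 0" by (metis fps_zero_nth)
  have "phi_eval p (?X ^ 2) * ?K = phi_eval p (?X ^ 2) * (1 + ?X ^ 2 + (?X ^ 2) ^ 2)"
    by (simp flip: power_mult)
  also have "\<dots> = 1 + (?X ^ 2) ^ p + (?X ^ 2) ^ (2 * p)"
    by (rule phi_eval_mult[OF u])
  also have "\<dots> = 1 + (?X ^ p) ^ 2 + (?X ^ p) ^ 4"
    by (simp only: power_mult[symmetric] mult.commute[of _ p] mult.assoc) simp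
  also have "\<dots> = (1 + ?X ^ p + (?X ^ p) ^ 2) * (1 - ?X ^ p + (?X ^ p) ^ 2)"
    by (rule quartic_factor[symmetric])
  also have "\<dots> = (1 + ?X ^ p + ?X ^ (2 * p)) * (1 + (- ?X) ^ p + (- ?X) ^ (2 * p))"
    using odd by (simp add: power_minus_odd mult.commute flip: power_mult)
  also have "\<dots> = (phi_eval p ?X * (1 + ?X + ?X ^ 2)) * (phi_eval p (- ?X) * (1 + (- ?X) + (- ?X) ^ 2))"
    by (simp only: phi_eval_mult[OF u])
  also have "\<dots> = phi_eval p ?X * phi_eval p (- ?X) * ((1 + ?X + ?X ^ 2) * (1 - ?X + ?X ^ 2))"
    by (simp only: mult_ac power2_minus add_uminus_conv_diff)
  also have "\<dots> = phi_eval p ?X * phi_eval p (- ?X) * ?K"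
    by (simp only: quartic_factor)
  finally show ?thesis using nz by simp
qed

section \<open>The periodic inverse of Phi_3p\<close>

definition inv_fps :: "nat \<Rightarrow> 'a::comm_ring_1 fps" where
  "inv_fps p = Abs_fps (\<lambda>k. of_int (inv_coeff p (int k)))"

text \<open>The factor \<open>1 - X^(3p)\<close> subtracts the sequence shifted by one period, so
  only the first period survives; its two blocks are the terms on the right.\<close>

lemma inv_fps_mult:
  assumes "p > 2"
  shows "inv_fps p * (1 - fps_X ^ (3 * p)) = (1 + fps_X + fps_X ^ 2) * (1 - (fps_X::'a::comm_ring_1 fps) ^ p)"
proof (rule fps_ext)
  fix k
  have "(1 + fps_X + fps_X ^ 2) * (1 - (fps_X::'a fps) ^ p)
    = 1 + fps_X ^ 1 + fps_X ^ 2 - fps_X ^ p - fps_X ^ (p + 1) - fps_X ^ (p + 2)"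
    by (simp add: algebra_simps eval_nat_numeral)
  then have R: "fps_nth ((1 + fps_X + fps_X ^ 2) * (1 - (fps_X::'a fps) ^ p)) k
    = of_int (of_bool (k \<le> 2) - of_bool (p \<le> k \<and> k \<le> p + 2))"
    using assms by (auto simp: fps_X_power_nth)
  have c: "inv_coeff p (int k) = of_bool (k mod (3 * p) \<le> 2) - of_bool (p \<le> k mod (3 * p) \<and> k mod (3 * p) \<le> p + 2)"
  proof -
    have "int k mod (3 * int p) = int (k mod (3 * p))" by (simp add: zmod_int)
    moreover define m where "m = k mod (3 * p)"
    moreover have "int m \<in> {0, 1, 2} \<longleftrightarrow> m \<le> 2" "int m \<in> {int p, int p + 1, int p + 2} \<longleftrightarrow> p \<le> m \<and> m \<le> p + 2"
      by auto
    ultimately show ?thesis using assms unfolding inv_coeff_def by auto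
  qed
  have "inv_coeff p (int k) - (if k < 3 * p then 0 else inv_coeff p (int (k - 3 * p)))
    = of_bool (k \<le> 2) - of_bool (p \<le> k \<and> k \<le> p + 2)"
  proof (cases "k < 3 * p")
    case True
    then show ?thesis using assms by (simp add: c)
  next
    case False
    then have "int (k - 3 * p) mod (3 * int p) = int k mod (3 * int p)"
      by (simp add: of_nat_diff)
    then show ?thesis using False assms by (simp add: inv_coeff_def)
  qed
  moreover have "fps_nth (inv_fps p * (1 - fps_X ^ (3 * p)) :: 'a fps) k
    = of_int (inv_coeff p (int k) - (if k < 3 * p then 0 else inv_coeff p (int (k - 3 * p))))"
    by (simp add: inv_fps_def right_diff_distrib fps_X_power_mult_right_nth)
  ultimately show "fps_nth (inv_fps p * (1 - fps_X ^ (3 * p)) :: 'a fps) k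
    = fps_nth ((1 + fps_X + fps_X ^ 2) * (1 - (fps_X::'a fps) ^ p)) k"
    using R by simp
qed

lemma one_minus_fps_X_power_nonzero: "n > 0 \<Longrightarrow> 1 - (fps_X::'a::comm_ring_1 fps) ^ n \<noteq> 0"
proof
  assume "n > 0" "1 - (fps_X::'a fps) ^ n = 0"
  then have "fps_nth (1 - (fps_X::'a fps) ^ n) 0 = 0" by simp
  then show False using \<open>n > 0\<close> by (simp add: fps_X_power_nth)
qed

lemma phi_eval_mult_inv_fps:
  assumes "p = 3 * u + 2" "p > 2"
  shows "phi_eval p fps_X * inv_fps p = (1 :: 'a::idom fps)"
proof -
  let ?X = "fps_X :: 'a fps"
  have "phi_eval p ?X * inv_fps p * (1 - ?X ^ (3 * p)) = phi_eval p ?X * (1 + ?X + ?X ^ 2) * (1 - ?X ^ p)"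
    by (simp only: mult.assoc inv_fps_mult[OF assms(2)])
  also have "\<dots> = (1 + ?X ^ p + (?X ^ p) ^ 2) * (1 - ?X ^ p)"
    using assms by (simp only: phi_eval_mult power_mult[symmetric] mult.commute[of 2])
  also have "\<dots> = 1 * (1 - (?X ^ p) ^ 3)"
    by (simp add: algebra_simps eval_nat_numeral)
  also have "(?X ^ p) ^ 3 = ?X ^ (3 * p)"
    by (simp add: mult.commute flip: power_mult)
  finally show ?thesis
    using one_minus_fps_X_power_nonzero[of "3 * p"] assms
    by (metis mult_cancel_right mult_pos_pos not_numeral_less_zero zero_less_numeral gr_implies_not0 neq0_conv)
qed

text \<open>Index \<open>j\<close> contributes only when \<open>e * j <= m\<close>, and
  \<open>2 * p - 2\<close> is the degree of Phi_3p. The truncation must be explicit because the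
  periodic \<open>inv_coeff\<close> need not vanish at negative arguments.\<close>

lemma fps_nth_phi_eval_mult:
  assumes "e > 0" "p > 0"
  shows "fps_nth (phi_eval p (fps_X ^ e) * inv_fps p :: 'a::comm_ring_1 fps) m
         = of_int (partial_conv p (int e) (min (m div e) (2 * p - 2)) (int m))"
proof -
  have "fps_nth (phi_eval p (fps_X ^ e) * inv_fps p :: 'a fps) m
     = (\<Sum>j<2*p-1. fps_nth (fps_const (of_int (phi_coeff p j)) * (fps_X ^ (e * j) * inv_fps p)) m)"
    unfolding phi_eval_def sum_distrib_right fps_sum_nth
    by (simp add: mult.assoc fps_of_int flip: power_mult)
  also have "\<dots> = (\<Sum>j<2*p-1. if m < e * j then 0 else of_int (phi_coeff p j * inv_coeff p (int m - int e * int j)))"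
    by (intro sum.cong refl) (auto simp: fps_X_power_mult_nth inv_fps_def of_nat_diff)
  also have "\<dots> = (\<Sum>j\<le>min (m div e) (2*p-2). of_int (phi_coeff p j * inv_coeff p (int m - int e * int j)))"
  proof (rule sum.mono_neutral_cong_right)
    show "{..min (m div e) (2*p-2)} \<subseteq> {..<2*p-1}" using assms by auto
    show "\<forall>i\<in>{..<2*p-1} - {..min (m div e) (2*p-2)}.
       (if m < e * i then 0 else of_int (phi_coeff p i * inv_coeff p (int m - int e * int i)) :: 'a) = 0"
      using assms by (auto simp: div_less_iff_less_mult mult.commute not_le less_eq_div_iff_mult_less_eq)
    show "(if m < e * x then 0 else of_int (phi_coeff p x * inv_coeff p (int m - int e * int x))) =
         (of_int (phi_coeff p x * inv_coeff p (int m - int e * int x)) :: 'a)"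
      if "x \<in> {..min (m div e) (2 * p - 2)}" for x
      using that assms by (auto simp: less_eq_div_iff_mult_less_eq mult.commute)
  qed auto
  finally show ?thesis by (simp add: partial_conv_def)
qed

section \<open>Cyclotomic polynomials of three primes\<close>

lemma finite_unity_roots: "n > 0 \<Longrightarrow> finite {z::complex. z ^ n = 1}"
  by (rule finite_roots_unity) simp

lemma power_minus_one_eq_prod:
  assumes "n > 0"
  shows "(\<Prod>z | z ^ n = (1::complex). [:- z, 1:]) = monom 1 n - 1"
proof -
  let ?f = "monom (1::complex) n - 1"
  have pl: "poly ?f z = z ^ n - 1" for z
    by (simp add: poly_monom)
  have deg: "degree ?f = n"
    using assms degree_add_eq_left[of "- 1" "monom (1::complex) n"] by (simp add: degree_monom_eq)
  have lc: "lead_coeff ?f = 1"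
    unfolding deg using assms by simp
  have "rsquarefree ?f"
    unfolding rsquarefree_roots pl using assms by (auto simp: pderiv_diff pderiv_monom poly_monom power_0_left)
  from complex_poly_decompose_rsquarefree[OF this] show ?thesis
    unfolding lc pl by simp
qed

lemma unity_root_gcd:
  fixes z :: "'a::idom"
  assumes "z ^ a = 1" "z ^ b = 1"
  shows "z ^ gcd a b = 1"
proof (cases "a = 0")
  case True
  then show ?thesis using assms by simp
next
  case False
  then obtain x y where xy: "a * x = b * y + gcd a b"
    using bezout_nat by blast
  have "z ^ (a * x) = z ^ (b * y) * z ^ gcd a b" unfolding xy by (simp add: power_add)
  then show ?thesis using assms by (simp add: power_mult)
qed

lemma unity_root_gcd_iff:
  fixes z :: "'a::idom"
  shows "z ^ a = 1 \<and> z ^ b = 1 \<longleftrightarrow> z ^ gcd a b = 1"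
proof
  assume "z ^ gcd a b = 1"
  moreover obtain k l where "a = gcd a b * k" "b = gcd a b * l"
    by (meson dvdE gcd_dvd1 gcd_dvd2)
  ultimately show "z ^ a = 1 \<and> z ^ b = 1"
    by (metis power_mult power_one)
qed (use unity_root_gcd in blast)

text \<open>If \<open>z^k = 1\<close> with \<open>0 < k < n\<close>, then \<open>z^d = 1\<close> for
  the proper divisor \<open>d = gcd k n\<close> of \<open>n\<close>; a prime \<open>r\<close>
  dividing the cofactor gives \<open>z^(n div r) = 1\<close>.\<close>

lemma primitive_iff_no_prime_quotient:
  assumes "n > 0"
  shows "primitive_root_of_unity n z \<longleftrightarrow> z ^ n = 1 \<and> (\<forall>r. prime r \<and> r dvd n \<longrightarrow> z ^ (n div r) \<noteq> 1)"
proof (intro iffI conjI allI impI; (elim conjE)?)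
  assume "primitive_root_of_unity n z"
  then show "z ^ n = 1" by (simp add: primitive_root_of_unity_def)
next
  fix r :: nat assume a: "primitive_root_of_unity n z" "prime r" "r dvd n"
  then have "0 < n div r" "n div r < n"
    using assms prime_gt_1_nat[of r] by (auto intro: div_less_dividend elim!: dvdE)
  then show "z ^ (n div r) \<noteq> 1" using a by (simp add: primitive_root_of_unity_def)
next
  assume z: "z ^ n = 1" and r: "\<forall>r. prime r \<and> r dvd n \<longrightarrow> z ^ (n div r) \<noteq> 1"
  show "primitive_root_of_unity n z"
    unfolding primitive_root_of_unity_def
  proof (intro conjI allI impI notI z)
    fix k assume k: "0 < k \<and> k < n" "z ^ k = 1"
    define d where "d = gcd k n"
    have zd: "z ^ d = 1" unfolding d_def by (rule unity_root_gcd) (use k z in auto)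
    have "d \<le> k" unfolding d_def using k by (intro dvd_imp_le) auto
    obtain m where m: "n = d * m" unfolding d_def by (meson dvdE gcd_dvd2)
    have "m \<noteq> 1" using m \<open>d \<le> k\<close> k by auto
    then obtain r where r': "prime r" "r dvd m" using prime_factor_nat by blast
    then obtain l where l: "m = r * l" by blast
    have "n div r = d * l" using m l r' prime_gt_0_nat[of r] by simp
    then have "z ^ (n div r) = 1" using zd by (simp add: power_mult)
    moreover have "r dvd n" using m r' by simp
    ultimately show False using r r' by blast
  qed
qed

text \<open>All binomials are written over the common index set of \<open>n\<close>-th roots of
  unity, so that products of them can be compared root by root.\<close>

lemma unity_prod_filter:
  assumes "m dvd n" "n > 0"
  shows "monom 1 m - 1 = (\<Prod>z | z ^ n = (1::complex). if z ^ m = 1 then [:- z, 1:] else 1)"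
proof -
  have "m > 0" using assms by (auto intro: Nat.gr0I)
  have "{z::complex. z ^ m = 1} = {z \<in> {z. z ^ n = 1}. z ^ m = 1}"
    using assms by (auto elim!: dvdE simp: power_mult)
  then have "monom 1 m - 1 = (\<Prod>z\<in>{z \<in> {z. z ^ n = 1}. z ^ m = 1}. [:- z, 1::complex:])"
    using power_minus_one_eq_prod[OF \<open>m > 0\<close>] by simp
  also have "\<dots> = (\<Prod>z | z ^ n = 1. if z ^ m = 1 then [:- z, 1:] else 1)"
    using finite_unity_roots[OF assms(2)] by (rule prod.inter_filter)
  finally show ?thesis .
qed

text \<open>The Moebius product formula with denominators cleared. For each root of unity
  \<open>z\<close> of order dividing \<open>a * b * c\<close>, the factors \<open>X - z\<close>
  occurring on the two sides are compared.\<close>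

lemma cyclotomic_poly_three_primes:
  fixes a b c :: nat
  assumes pr: "prime a" "prime b" "prime c" and ne: "a \<noteq> b" "a \<noteq> c" "b \<noteq> c"
  shows "cyclotomic_poly (a * b * c) * ((monom 1 (b * c) - 1) * (monom 1 (a * c) - 1) * (monom 1 (a * b) - 1) * (monom 1 1 - 1))
    = (monom 1 (a * b * c) - 1) * (monom 1 a - 1) * (monom 1 b - 1) * (monom 1 c - 1)"
proof -
  define n where "n = a * b * c"
  have pos: "a > 0" "b > 0" "c > 0" using pr by (auto simp: prime_gt_0_nat)
  then have n: "n > 0" unfolding n_def by simp
  have cop: "coprime a b" "coprime a c" "coprime b c" using pr ne by (simp_all add: primes_coprime)
  have g: "gcd (a * c) (a * b) = a" "gcd (b * c) (a * b) = b" "gcd (b * c) (a * c) = c" "gcd (b * c) a = 1"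
  proof -
    have "gcd (x * y) (x * z) = x" if "coprime y z" for x y z :: nat
      using gcd_mult_distrib_nat[of x y z] that by simp
    then show "gcd (a * c) (a * b) = a" "gcd (b * c) (a * b) = b" "gcd (b * c) (a * c) = c"
      using cop by (metis coprime_commute mult.commute)+
    show "gcd (b * c) a = 1"
      using cop by (simp add: coprime_commute coprime_imp_gcd_eq_1)
  qed
  have quot: "n div a = b * c" "n div b = a * c" "n div c = a * b"
    using pos by (simp_all add: n_def)
  have dvdn: "r dvd n \<longleftrightarrow> r = a \<or> r = b \<or> r = c" if "prime r" for r
    using that pr by (auto simp: n_def prime_dvd_mult_iff primes_dvd_imp_eq)
  define f where "f z = [:- z, 1::complex:]" for z
  define P where "P m = (\<lambda>z::complex. if z ^ m = 1 then f z else 1)" for m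
  have P: "monom 1 m - 1 = (\<Prod>z | z ^ n = 1. P m z)" if "m dvd n" for m
    using unity_prod_filter[OF that n] unfolding P_def f_def .
  have prim: "primitive_root_of_unity n z \<longleftrightarrow> z ^ n = 1 \<and> z ^ (b * c) \<noteq> 1 \<and> z ^ (a * c) \<noteq> 1 \<and> z ^ (a * b) \<noteq> 1" for z
    unfolding primitive_iff_no_prime_quotient[OF n] using dvdn quot pr by metis
  have "{z. primitive_root_of_unity n z} = {z \<in> {z. z ^ n = 1}. primitive_root_of_unity n z}"
    unfolding prim by auto
  then have "cyclotomic_poly n = (\<Prod>z\<in>{z \<in> {z. z ^ n = 1}. primitive_root_of_unity n z}. f z)"
    unfolding cyclotomic_poly_def f_def by simp
  then have cyc: "cyclotomic_poly n = (\<Prod>z | z ^ n = 1. if primitive_root_of_unity n z then f z else 1)"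
    using prod.inter_filter[OF finite_unity_roots[OF n]] by simp
  have dv: "b * c dvd n" "a * c dvd n" "a * b dvd n" "1 dvd n" "n dvd n" "a dvd n" "b dvd n" "c dvd n"
    by (simp_all add: n_def)
  have pw: "(if primitive_root_of_unity n z then f z else 1) * (P (b * c) z * P (a * c) z * P (a * b) z * P 1 z)
        = P n z * P a z * P b z * P c z" if "z ^ n = 1" for z
  proof -
    \<comment> \<open>The gcds in \<open>g\<close> reduce every condition on \<open>z\<close> to the
      exponents \<open>b * c\<close>, \<open>a * c\<close> and \<open>a * b\<close>; what remains is
      propositional.\<close>
    have e: "z ^ a = 1 \<longleftrightarrow> z ^ (a * c) = 1 \<and> z ^ (a * b) = 1" "z ^ b = 1 \<longleftrightarrow> z ^ (b * c) = 1 \<and> z ^ (a * b) = 1"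
      "z ^ c = 1 \<longleftrightarrow> z ^ (b * c) = 1 \<and> z ^ (a * c) = 1"
      "z ^ 1 = 1 \<longleftrightarrow> z ^ (b * c) = 1 \<and> z ^ (a * c) = 1 \<and> z ^ (a * b) = 1"
      by (simp_all only: unity_root_gcd_iff g)
    show ?thesis
      unfolding P_def prim e using that by (auto simp: mult_ac)
  qed
  show ?thesis
    unfolding n_def[symmetric] cyc P[OF dv(1)] P[OF dv(2)] P[OF dv(3)] P[OF dv(4)] P[OF dv(5)] P[OF dv(6)] P[OF dv(7)] P[OF dv(8)]
      prod.distrib[symmetric]
    by (intro prod.cong refl) (use pw in simp)
qed

text \<open>Of the eight binomials in the three-prime formula, those in powers of \<open>X^q\<close>
  give Phi_3p(X^q) and the others give 1 / Phi_3p. The signs cancel, four on each side.\<close>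

lemma fps_cyclotomic_poly:
  assumes "prime p" "prime q" "p \<noteq> q" "p mod 3 = 2" "3 \<noteq> q" "p > 2"
  shows "fps_of_poly (cyclotomic_poly (3 * p * q)) = phi_eval p (fps_X ^ q) * inv_fps p"
proof -
  obtain u where u: "p = 3 * u + 2" using assms(4) by (metis mult_div_mod_eq)
  let ?X = "fps_X :: complex fps"
  define D where "D m = 1 - ?X ^ m" for m
  have Dnz: "D m \<noteq> 0" if "m > 0" for m unfolding D_def using that by (rule one_minus_fps_X_power_nonzero)
  have fp: "fps_of_poly (monom 1 m - 1) = - D m" for m
    by (simp add: D_def fps_of_poly_diff fps_of_poly_monom)
  have cube: "(1 + y + y ^ 2) * (1 - y) = 1 - y ^ 3" for y :: "complex fps"
    by (simp add: algebra_simps eval_nat_numeral)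
  have pos: "p > 0" "q > 0" using assms by (simp_all add: prime_gt_0_nat)
  let ?K = "D (p * q) * D (3 * q) * D (3 * p) * D 1"
  have "prime (3::nat)" by simp
  from cyclotomic_poly_three_primes[OF this assms(1,2)] assms
  have "cyclotomic_poly (3 * p * q) * ((monom 1 (p * q) - 1) * (monom 1 (3 * q) - 1) * (monom 1 (3 * p) - 1) * (monom 1 1 - 1))
    = (monom 1 (3 * p * q) - 1) * (monom 1 3 - 1) * (monom 1 p - 1) * (monom 1 q - 1)"
    by force
  from arg_cong[OF this, of fps_of_poly]
  have 1: "fps_of_poly (cyclotomic_poly (3 * p * q)) * ?K = D (3 * p * q) * D 3 * D p * D q"
    by (simp only: fps_of_poly_mult fp minus_mult_minus mult_minus_left mult_minus_right minus_minus)
  have DD: "D (3 * p * q) * D q = phi_eval p (?X ^ q) * D (p * q) * D (3 * q)"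
  proof -
    let ?Y = "?X ^ q"
    have "?Y ^ (2 * p) = (?Y ^ p) ^ 2" by (simp add: mult_ac flip: power_mult)
    with phi_eval_mult[OF u, of ?Y]
    have m: "phi_eval p ?Y * (1 + ?Y + ?Y ^ 2) = 1 + ?Y ^ p + (?Y ^ p) ^ 2" by simp
    have "phi_eval p ?Y * ((1 + ?Y + ?Y ^ 2) * (1 - ?Y)) * (1 - ?Y ^ p)
      = phi_eval p ?Y * (1 + ?Y + ?Y ^ 2) * (1 - ?Y) * (1 - ?Y ^ p)"
      by (simp only: mult.assoc)
    also have "\<dots> = ((1 + ?Y ^ p + (?Y ^ p) ^ 2) * (1 - ?Y ^ p)) * (1 - ?Y)"
      unfolding m by (simp only: mult_ac)
    finally have "phi_eval p ?Y * (1 - ?Y ^ 3) * (1 - ?Y ^ p) = (1 - (?Y ^ p) ^ 3) * (1 - ?Y)"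
      by (simp only: cube)
    then show ?thesis unfolding D_def by (simp add: mult_ac flip: power_mult)
  qed
  have D3: "D 3 * D p = inv_fps p * D (3 * p) * D 1"
  proof -
    have "inv_fps p * D (3 * p) * D 1 = (1 + ?X + ?X ^ 2) * (1 - ?X ^ p) * (1 - ?X)"
      by (simp only: D_def inv_fps_mult[OF assms(6)] power_one_right)
    also have "\<dots> = (1 + ?X + ?X ^ 2) * (1 - ?X) * (1 - ?X ^ p)"
      by (simp only: mult_ac)
    finally show ?thesis by (simp only: cube D_def)
  qed
  have "D (3 * p * q) * D 3 * D p * D q = (D (3 * p * q) * D q) * (D 3 * D p)"
    by (simp only: mult_ac)
  also have "\<dots> = (phi_eval p (?X ^ q) * inv_fps p) * ?K"
    unfolding DD D3 by (simp only: mult_ac)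
  finally have "fps_of_poly (cyclotomic_poly (3 * p * q)) * ?K = (phi_eval p (?X ^ q) * inv_fps p) * ?K"
    unfolding 1 .
  moreover have "?K \<noteq> 0" using pos Dnz by simp
  ultimately show ?thesis by (metis mult_right_cancel)
qed

section \<open>Rows of coefficients\<close>

text \<open>As \<open>x\<close> is invertible modulo \<open>n\<close>, the affine map permutes the
  residues, and \<open>f\<close> depends only on the residue.\<close>

lemma sum_periodic_affine:
  fixes f :: "int \<Rightarrow> nat" and n :: nat
  assumes n: "n > 0" and per: "\<And>r. f (r mod int n) = f r" and cop: "coprime x (int n)"
  shows "(\<Sum>u<n. f (x * int u + y)) = (\<Sum>u<n. f (int u))"
proof -
  define g where "g u = nat ((x * int u + y) mod int n)" for u
  have gn: "int (g u) = (x * int u + y) mod int n" for u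
    using n by (simp add: g_def)
  have "inj_on g {..<n}"
  proof (rule inj_onI)
    fix u v assume uv: "u \<in> {..<n}" "v \<in> {..<n}" "g u = g v"
    then have "(x * int u + y) mod int n = (x * int v + y) mod int n"
      using gn by metis
    then have "int n dvd x * (int u - int v)"
      by (simp add: mod_eq_dvd_iff algebra_simps)
    then have "int n dvd int u - int v"
      using cop by (simp add: coprime_dvd_mult_right_iff coprime_commute)
    then have "int u mod int n = int v mod int n"
      by (simp add: mod_eq_dvd_iff)
    then show "u = v" using uv by simp
  qed
  moreover have "g ` {..<n} \<subseteq> {..<n}"
    using n by (auto simp: g_def nat_less_iff)
  ultimately have "bij_betw g {..<n} {..<n}"
    by (simp add: bij_betw_def endo_inj_surj)
  then have "(\<Sum>u<n. f (int u)) = (\<Sum>u<n. f (int (g u)))"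
    by (rule sum.reindex_bij_betw[symmetric])
  then show ?thesis by (simp add: gn per)
qed

lemma sum_periods:
  fixes f :: "int \<Rightarrow> nat" and n :: nat
  assumes n: "n > 0" and per: "\<And>r. f (r mod int n) = f r"
  shows "(\<Sum>u<k * n. f (int u + y)) = k * (\<Sum>u<n. f (int u))"
proof -
  have "(\<Sum>u<k * n. f (int u + y)) = (\<Sum>m<k. \<Sum>u=m*n..<m*n+n. f (int u + y))"
    by (rule sum.nat_group[symmetric])
  also have "\<dots> = (\<Sum>m<k. \<Sum>u<n. f (int u))"
  proof (rule sum.cong[OF refl])
    fix m
    have "(\<Sum>u=m*n..<m*n+n. f (int u + y)) = (\<Sum>u<n. f (1 * int u + (int (m * n) + y)))"
      using sum.shift_bounds_nat_ivl[of "\<lambda>u. f (int u + y)" 0 "m * n" n]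
      by (simp add: atLeast0LessThan add_ac)
    then show "(\<Sum>u=m*n..<m*n+n. f (int u + y)) = (\<Sum>u<n. f (int u))"
      using sum_periodic_affine[of n f 1, OF n per] by simp
  qed
  finally show ?thesis by simp
qed

section \<open>Symmetries of the partial convolutions\<close>

lemma inv_coeff_cong: "r mod (3 * int p) = r' mod (3 * int p) \<Longrightarrow> inv_coeff p r = inv_coeff p r'"
  by (simp add: inv_coeff_def)

text \<open>The reflection exchanges the block 0, 1, 2 carrying 1 with the block p, p + 1, p + 2
  carrying -1.\<close>

lemma inv_coeff_reflect:
  assumes "p > 2"
  shows "inv_coeff p (int p + 2 - r) = - inv_coeff p r"
proof -
  define m where "m = r mod (3 * int p)"
  have m: "0 \<le> m" "m < 3 * int p" using assms by (simp_all add: m_def)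
  have eq: "(int p + 2 - r) mod (3 * int p) = (int p + 2 - m) mod (3 * int p)"
    unfolding m_def by (simp add: mod_diff_right_eq)
  show ?thesis
  proof (cases "m \<le> int p + 2")
    case True
    then have "(int p + 2 - m) mod (3 * int p) = int p + 2 - m"
      using m assms by (intro mod_pos_pos_trivial) auto
    then show ?thesis unfolding inv_coeff_def eq m_def[symmetric] using assms by auto
  next
    case False
    then have "(int p + 2 - m + 3 * int p) mod (3 * int p) = int p + 2 - m + 3 * int p"
      using m assms by (intro mod_pos_pos_trivial) auto
    then have "(int p + 2 - m) mod (3 * int p) = int p + 2 - m + 3 * int p"
      by (simp only: mod_add_self2)
    then show ?thesis unfolding inv_coeff_def eq m_def[symmetric] using assms False m by auto
  qed
qed

lemma partial_conv_cong:
  assumes "e mod (3 * int p) = e' mod (3 * int p)" "r mod (3 * int p) = r' mod (3 * int p)"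
  shows "partial_conv p e t r = partial_conv p e' t r'"
  unfolding partial_conv_def
proof (intro sum.cong refl)
  fix j
  have "(r - e * int j) mod (3 * int p) = (r' - e' * int j) mod (3 * int p)"
    by (intro mod_diff_cong mod_mult_cong assms refl)
  then show "phi_coeff p j * inv_coeff p (r - e * int j) = phi_coeff p j * inv_coeff p (r' - e' * int j)"
    using inv_coeff_cong by metis
qed

lemma partial_conv_uminus:
  assumes "p > 2"
  shows "partial_conv p (- e) t r = - partial_conv p e t (int p + 2 - r)"
proof -
  have "inv_coeff p (r + e * int j) = - inv_coeff p (int p + 2 - r - e * int j)" for j
    using inv_coeff_reflect[OF assms, of "r + e * int j"] by (simp add: algebra_simps)
  then show ?thesis unfolding partial_conv_def by (simp add: sum_negf)
qed

text \<open>Phi_3p is palindromic: \<open>2 * p - 2\<close> is 2 modulo 3, so reflection swaps the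
  residues 0 and 2 and the two ranges; only the middle index \<open>p - 1\<close>, of residue 1, is
  fixed.\<close>

lemma phi_coeff_reflect:
  assumes "p mod 3 = 2" "j \<le> 2 * p - 2"
  shows "phi_coeff p (2 * p - 2 - j) = phi_coeff p j"
proof -
  obtain u where u: "p = 3 * u + 2" using assms(1) by (metis mult_div_mod_eq)
  define i where "i = 2 * p - 2 - j"
  then have i: "i + j = 6 * u + 2" "2 * p - 2 - j = i"
    using assms(2) u by simp_all
  have "i mod 3 = 0 \<and> j mod 3 = 2 \<or> i mod 3 = 1 \<and> j mod 3 = 1 \<or> i mod 3 = 2 \<and> j mod 3 = 0"
  proof -
    have "(i + j) mod 3 = 2" unfolding i(1) by presburger
    then show ?thesis by presburger
  qed
  moreover have "i < p \<longleftrightarrow> 3 * u < j" "j < p \<longleftrightarrow> 3 * u < i" "i < 2 * p - 1" "j < 2 * p - 1"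
    using i(1) u by auto
  moreover have "i = j" if "i < p" "j < p"
    using that i(1) u by linarith
  moreover have "i < p \<or> j < p"
    using i(1) u by linarith
  ultimately show ?thesis unfolding phi_coeff_def i(2) by auto
qed

text \<open>The left side is a coefficient of Phi_3p(X^2) / Phi_3p(X), which by
  \<open>phi_eval_square\<close> is Phi_3p(-X).\<close>

lemma partial_conv_two:
  assumes "p = 6 * s + 5"
  shows "partial_conv p 2 (min (m div 2) (2 * p - 2)) (int m) = (- 1) ^ m * phi_coeff p m"
proof -
  have u: "p = 3 * (2 * s + 1) + 2" "p > 2" "p > 0" using assms by simp_all
  let ?X = "fps_X :: int fps"
  have "phi_eval p (?X ^ 2) * inv_fps p = phi_eval p (- ?X) * (phi_eval p ?X * inv_fps p)"
    unfolding phi_eval_square[OF assms] by (simp only: mult_ac)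
  also have "\<dots> = phi_eval p (- ?X)"
    unfolding phi_eval_mult_inv_fps[OF u(1,2)] by simp
  also have "fps_nth \<dots> m = (\<Sum>j<2*p-1. if j = m then (- 1) ^ j * phi_coeff p j else 0)"
    unfolding phi_eval_def fps_sum_nth
  proof (intro sum.cong refl)
    fix j
    have "of_int c = fps_const c" for c :: int
      using fps_of_int[of c, where 'a = int] by simp
    then have "of_int (phi_coeff p j) * (- ?X) ^ j = fps_const (phi_coeff p j * (- 1) ^ j) * ?X ^ j"
      by (simp add: power_minus[of ?X] fps_const_power[symmetric] fps_const_neg[symmetric]
        del: fps_const_neg fps_const_power flip: fps_const_mult)
    then show "fps_nth (of_int (phi_coeff p j) * (- ?X) ^ j) m = (if j = m then (- 1) ^ j * phi_coeff p j else 0)"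
      by (simp add: fps_X_power_nth)
  qed
  also have "\<dots> = (- 1) ^ m * phi_coeff p m"
    using u by (auto simp: phi_coeff_def)
  finally show ?thesis
    using fps_nth_phi_eval_mult[of 2 p m, where 'a = int] u by simp
qed

lemma partial_conv_full:
  assumes "p = 6 * s + 5"
  shows "partial_conv p 2 (2 * p - 2) r = 0"
proof -
  \<comment> \<open>Adding two periods leaves the convolution unchanged and moves the index beyond
    the degree, where the cap \<open>2 * p - 2\<close> is attained.\<close>
  define m where "m = nat (r mod (3 * int p)) + 6 * p"
  have m: "int m = r mod (3 * int p) + 2 * (3 * int p)" using assms by (simp add: m_def)
  have "m div 2 \<ge> 2 * p - 2" by (simp add: m_def)
  then have "partial_conv p 2 (2 * p - 2) (int m) = (- 1) ^ m * phi_coeff p m"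
    using partial_conv_two[OF assms, of m] by (simp add: min_absorb2)
  also have "phi_coeff p m = 0" using assms by (simp add: m_def phi_coeff_def)
  finally have "partial_conv p 2 (2 * p - 2) (int m) = 0" by simp
  moreover have "int m mod (3 * int p) = r mod (3 * int p)" unfolding m by (simp only: mod_mult_self1 mod_mod_trivial)
  ultimately show ?thesis using partial_conv_cong[OF refl, of "int m" p r] by simp
qed

text \<open>The full sum vanishes, so the sum up to \<open>t\<close> is minus the complementary sum.
  Reversing the latter, with \<open>phi_coeff\<close> palindromic, reflects \<open>inv_coeff\<close>
  and brings a second minus sign.\<close>

lemma partial_conv_reflect:
  assumes p: "p = 6 * s + 5" and t: "t \<le> 2 * p - 3"
  shows "partial_conv p 2 t r = partial_conv p 2 (2 * p - 3 - t) (5 * int p - 2 - r)"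
proof -
  let ?g = "\<lambda>j. phi_coeff p j * inv_coeff p (r - 2 * int j)"
  have p2: "p > 2" "p mod 3 = 2" using p by (simp, presburger)
  have "{..2 * p - 2} = {..t} \<union> {Suc t..2 * p - 2}" using t p by auto
  then have "partial_conv p 2 (2 * p - 2) r = partial_conv p 2 t r + (\<Sum>j=Suc t..2*p-2. ?g j)"
    unfolding partial_conv_def by (simp add: sum.union_disjoint Int_def)
  then have "partial_conv p 2 t r = - (\<Sum>j=Suc t..2*p-2. ?g j)"
    using partial_conv_full[OF p] by simp
  also have "(\<Sum>j=Suc t..2*p-2. ?g j) = (\<Sum>i\<le>2*p-3-t. ?g (2 * p - 2 - i))"
    by (rule sum.reindex_bij_witness[where i="\<lambda>i. 2 * p - 2 - i" and j="\<lambda>i. 2 * p - 2 - i"])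
      (use t p in auto)
  also have "\<dots> = (\<Sum>i\<le>2*p-3-t. - (phi_coeff p i * inv_coeff p (5 * int p - 2 - r - 2 * int i)))"
  proof (intro sum.cong refl)
    fix i assume "i \<in> {..2*p-3-t}"
    then have i: "i \<le> 2 * p - 2" by auto
    have h: "int p + 2 - (r - 2 * int (2 * p - 2 - i)) = 5 * int p - 2 - r - 2 * int i"
      using i p by (simp add: of_nat_diff)
    have "inv_coeff p (r - 2 * int (2 * p - 2 - i)) = - inv_coeff p (5 * int p - 2 - r - 2 * int i)"
      using inv_coeff_reflect[OF p2(1), of "r - 2 * int (2 * p - 2 - i)"] unfolding h by linarith
    then show "?g (2 * p - 2 - i) = - (phi_coeff p i * inv_coeff p (5 * int p - 2 - r - 2 * int i))"
      using phi_coeff_reflect[OF p2(2) i] by simp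
  qed
  finally show ?thesis by (simp add: partial_conv_def sum_negf)
qed

definition nonzero_count :: "nat \<Rightarrow> nat \<Rightarrow> nat" where
  "nonzero_count p t = (\<Sum>u<3 * p. of_bool (partial_conv p 2 t (int u) \<noteq> 0))"

lemma partial_conv_mod: "partial_conv p e t (r mod int (3 * p)) = partial_conv p e t r"
  by (rule partial_conv_cong) auto

lemma nonzero_count_affine:
  assumes "p > 0" "coprime x (int (3 * p))"
  shows "(\<Sum>u<3 * p. of_bool (partial_conv p 2 t (x * int u + y) \<noteq> 0)) = nonzero_count p t"
  unfolding nonzero_count_def
  by (rule sum_periodic_affine[where f = "\<lambda>r. of_bool (partial_conv p 2 t r \<noteq> 0)"])
    (use assms partial_conv_mod[of p 2 t] in auto)

lemma nonzero_count_reflect: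
  assumes p: "p = 6 * s + 5" and t: "t \<le> 2 * p - 3"
  shows "nonzero_count p (2 * p - 3 - t) = nonzero_count p t"
proof -
  have "nonzero_count p t = (\<Sum>u<3 * p. of_bool (partial_conv p 2 (2 * p - 3 - t) ((- 1) * int u + (5 * int p - 2)) \<noteq> 0))"
    unfolding nonzero_count_def partial_conv_reflect[OF p t] by (simp add: algebra_simps)
  then show ?thesis using nonzero_count_affine[of p "- 1"] p by simp
qed

text \<open>The value is \<open>(4 * p + 1) / 3\<close>. Below
  \<open>2 * p - 1 = 3 * (4 * s + 3)\<close> residue 1 always counts, residue 0 only below
  \<open>p\<close>, and residue 2 only from \<open>p\<close> on.\<close>

lemma sum_phi_coeff_nonzero:
  assumes p: "p = 6 * s + 5"
  shows "(\<Sum>t<2*p-2. of_bool (phi_coeff p (2 * t) \<noteq> 0) + of_bool (phi_coeff p (2 * t + 1) \<noteq> 0)) = 8 * s + 7"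
proof -
  let ?b = "\<lambda>j. of_bool (phi_coeff p j \<noteq> 0) :: nat"
  have double: "(\<Sum>t<n. ?b (2 * t) + ?b (2 * t + 1)) = (\<Sum>j<2*n. ?b j)" for n
    by (induction n) simp_all
  have "(\<Sum>j<2*(2*p-2). ?b j) = (\<Sum>j<3*(4*s+3). ?b j)"
    by (rule sum.mono_neutral_right) (use p in \<open>auto simp: phi_coeff_def\<close>)
  also have "\<dots> = (\<Sum>i<4*s+3. ?b (3 * i) + ?b (3 * i + 1) + ?b (3 * i + 2))"
    by (rule sum_lessThan_triple)
  also have "\<dots> = (\<Sum>i<4*s+3. of_bool (i < 2 * s + 2) + 1 + of_bool (2 * s + 1 \<le> i))"
  proof (intro sum.cong refl)
    fix i assume "i \<in> {..<4*s+3}"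
    then have "phi_coeff p (3 * i) \<noteq> 0 \<longleftrightarrow> i < 2 * s + 2" "phi_coeff p (3 * i + 1) \<noteq> 0"
        "phi_coeff p (3 * i + 2) \<noteq> 0 \<longleftrightarrow> 2 * s + 1 \<le> i"
      unfolding phi_coeff_def p by (auto simp: mod_triple)
    then show "?b (3 * i) + ?b (3 * i + 1) + ?b (3 * i + 2) = of_bool (i < 2 * s + 2) + 1 + of_bool (2 * s + 1 \<le> i)"
      by simp
  qed
  also have "\<dots> = 8 * s + 7"
  proof -
    have "{..<4*s+3} \<inter> {i. i < 2 * s + 2} = {..<2*s+2}" "{..<4*s+3} \<inter> {i. 2 * s + 1 \<le> i} = {2*s+1..<4*s+3}"
      by auto
    then show ?thesis by (simp only: sum.distrib sum_of_bool_eq finite_lessThan) simp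
  qed
  finally show ?thesis unfolding double .
qed

section \<open>Nonzero entries in a period\<close>

lemma sum_lessThan_add:
  fixes f :: "nat \<Rightarrow> 'a::comm_monoid_add"
  shows "(\<Sum>i<a + b. f i) = (\<Sum>i<a. f i) + (\<Sum>i<b. f (i + a))"
  by (induction b) (simp_all add: add_ac)

text \<open>Extension by 0 to all integers lets shifted copies be added without range
  conditions.\<close>

definition trunc_coeff :: "nat \<Rightarrow> nat \<Rightarrow> int \<Rightarrow> int" where
  "trunc_coeff p t i = (if 0 \<le> i \<and> i \<le> int t then phi_coeff p (nat i) else 0)"

lemma sum_trunc_coeff:
  "(\<Sum>j\<le>t. phi_coeff p j * of_bool (x - int j = v)) = trunc_coeff p t (x - v)"
proof (cases "0 \<le> x - v \<and> x - v \<le> int t")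
  case True
  then have "(\<Sum>j\<le>t. phi_coeff p j * of_bool (x - int j = v)) = (\<Sum>j\<le>t. if j = nat (x - v) then phi_coeff p j else 0)"
    by (intro sum.cong refl) auto
  then show ?thesis using True by (simp add: trunc_coeff_def nat_le_iff)
next
  case False
  then have "(\<Sum>j\<le>t. phi_coeff p j * of_bool (x - int j = v)) = 0"
    by (intro sum.neutral) auto
  then show ?thesis by (simp only: trunc_coeff_def False if_False)
qed

text \<open>The congruences \<open>2 * i\<close> = 0, 1, 2, p, p + 1, p + 2 modulo
  \<open>3 * p\<close> are solved: 0, 2 and p + 1 are reached directly, the others after subtracting
  \<open>3 * p\<close> once. The strict lower bound excludes \<open>1 - p\<close>, a second solution
  for p + 2.\<close>

lemma inv_coeff_double:
  assumes p: "p = 6 * s + 5" and "1 - int p < i" "i < 3 * int p"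
  shows "inv_coeff p (2 * i) = of_bool (i = 0) + of_bool (i = 1) + of_bool (i = 9 * int s + 8)
      - of_bool (i = 2 * int p) - of_bool (i = 2 * int p + 1) - of_bool (i = 3 * int s + 3)"
proof -
  consider "i < 0" | "0 \<le> i" "2 * i < 3 * int p" | "3 * int p \<le> 2 * i" by linarith
  then show ?thesis
  proof cases
    case 1
    have "(2 * i) mod (3 * int p) = (2 * i + 3 * int p) mod (3 * int p)" by (simp only: mod_add_self2)
    also have "\<dots> = 2 * i + 3 * int p" using assms 1 by (intro mod_pos_pos_trivial) auto
    finally have m: "(2 * i) mod (3 * int p) = 2 * i + 3 * int p" .
    show ?thesis unfolding inv_coeff_def m using assms 1 by auto
  next
    case 2
    then have m: "(2 * i) mod (3 * int p) = 2 * i" by (intro mod_pos_pos_trivial) auto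
    have "2 * i \<noteq> 1" "2 * i \<noteq> int p" "2 * i \<noteq> int p + 2" using p by presburger+
    then show ?thesis unfolding inv_coeff_def m using p 2 by auto
  next
    case 3
    have "(2 * i) mod (3 * int p) = (2 * i - 3 * int p) mod (3 * int p)" by (simp only: minus_mod_self2)
    also have "\<dots> = 2 * i - 3 * int p" using assms 3 by (intro mod_pos_pos_trivial) auto
    finally have m: "(2 * i) mod (3 * int p) = 2 * i - 3 * int p" .
    have "2 * i - 3 * int p \<noteq> 0" "2 * i - 3 * int p \<noteq> 2" "2 * i - 3 * int p \<noteq> int p + 1" using p by presburger+
    then show ?thesis unfolding inv_coeff_def m using p 3 by auto
  qed
qed

text \<open>For \<open>j <= t <= p - 2\<close> the argument \<open>x - j\<close> stays in the window
  of \<open>inv_coeff_double\<close>, and each of the six points there yields one shift.\<close>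

lemma partial_conv_double:
  assumes p: "p = 6 * s + 5" and t: "t \<le> p - 2" and x: "0 \<le> x" "x < 3 * int p"
  shows "partial_conv p 2 t (2 * x) = trunc_coeff p t x + trunc_coeff p t (x - 1)
      + trunc_coeff p t (x - (9 * int s + 8)) - trunc_coeff p t (x - 2 * int p)
      - trunc_coeff p t (x - (2 * int p + 1)) - trunc_coeff p t (x - (3 * int s + 3))"
proof -
  have "partial_conv p 2 t (2 * x) = (\<Sum>j\<le>t. phi_coeff p j * inv_coeff p (2 * (x - int j)))"
    by (simp add: partial_conv_def algebra_simps)
  also have "\<dots> = (\<Sum>j\<le>t. phi_coeff p j * (of_bool (x - int j = 0) + of_bool (x - int j = 1)
      + of_bool (x - int j = 9 * int s + 8) - of_bool (x - int j = 2 * int p)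
      - of_bool (x - int j = 2 * int p + 1) - of_bool (x - int j = 3 * int s + 3)))"
  proof (intro sum.cong refl arg_cong[where f = "\<lambda>y. _ * y"])
    fix j assume "j \<in> {..t}"
    then have "1 - int p < x - int j" "x - int j < 3 * int p" using t x p by auto
    then show "inv_coeff p (2 * (x - int j)) = of_bool (x - int j = 0) + of_bool (x - int j = 1)
      + of_bool (x - int j = 9 * int s + 8) - of_bool (x - int j = 2 * int p)
      - of_bool (x - int j = 2 * int p + 1) - of_bool (x - int j = 3 * int s + 3)"
      by (rule inv_coeff_double[OF p])
  qed
  also have "\<dots> = trunc_coeff p t (x - 0) + trunc_coeff p t (x - 1)
      + trunc_coeff p t (x - (9 * int s + 8)) - trunc_coeff p t (x - 2 * int p)
      - trunc_coeff p t (x - (2 * int p + 1)) - trunc_coeff p t (x - (3 * int s + 3))"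
    by (simp only: sum_trunc_coeff[symmetric] distrib_left right_diff_distrib sum.distrib sum_subtractf)
  finally show ?thesis by simp
qed

text \<open>Since \<open>3 * p\<close> is odd, arguments may be doubled. The support of
  \<open>A\<close> lies between 0 and \<open>6 * s + 3\<close>, so cutting the period at
  \<open>9 * s + 8\<close> leaves three of the six shifts in each part.\<close>

lemma nonzero_count_halves:
  assumes p: "p = 6 * s + 5" and t: "t \<le> p - 2"
  defines "A \<equiv> trunc_coeff p t"
  shows "nonzero_count p t =
      (\<Sum>i<9*s+9. of_bool (A (int i) + A (int i - 1) - A (int i - (3 * int s + 3)) \<noteq> 0))
    + (\<Sum>i<9*s+9. of_bool (A (int i) - A (int i - (3 * int s + 2)) - A (int i - (3 * int s + 3)) \<noteq> 0))"
    (is "_ = (\<Sum>i<_. ?f i) + (\<Sum>i<_. ?g i)")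
proof -
  have A0: "A i = 0" if "i < 0 \<or> i > 6 * int s + 3" for i
    using that t p by (auto simp: A_def trunc_coeff_def)
  have "coprime 2 (int (3 * p))" using p by (simp add: coprime_left_2_iff_odd)
  then have "nonzero_count p t = (\<Sum>u<3 * p. of_bool (partial_conv p 2 t (2 * int u) \<noteq> 0))"
    using nonzero_count_affine[of p 2 t 0] p by simp
  also have "3 * p = 9 * s + 8 + (9 * s + 7)"
    using p by simp
  also have "(\<Sum>u<9 * s + 8 + (9 * s + 7). of_bool (partial_conv p 2 t (2 * int u) \<noteq> 0) :: nat)
      = (\<Sum>u<9*s+8. of_bool (partial_conv p 2 t (2 * int u) \<noteq> 0))
      + (\<Sum>i<9*s+7. of_bool (partial_conv p 2 t (2 * int (i + (9*s+8))) \<noteq> 0))"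
    by (rule sum_lessThan_add)
  also have "(\<Sum>u<9*s+8. of_bool (partial_conv p 2 t (2 * int u) \<noteq> 0)) = (\<Sum>u<9*s+8. ?f u)"
  proof (intro sum.cong refl)
    fix u assume "u \<in> {..<9*s+8}"
    then have "partial_conv p 2 t (2 * int u) = A (int u) + A (int u - 1) - A (int u - (3 * int s + 3))"
      using partial_conv_double[OF p t, of "int u"] p A0 unfolding A_def[symmetric] by simp
    then show "of_bool (partial_conv p 2 t (2 * int u) \<noteq> 0) = ?f u" by simp
  qed
  \<comment> \<open>Padding with a zero entry to a multiple of 3 prepares the grouping by
    residues.\<close>
  also have "\<dots> = (\<Sum>u<9*s+9. ?f u)"
    by (rule sum.mono_neutral_left) (auto simp: A0)
  also have "(\<Sum>i<9*s+7. of_bool (partial_conv p 2 t (2 * int (i + (9*s+8))) \<noteq> 0)) = (\<Sum>u<9*s+7. ?g u)"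
  proof (intro sum.cong refl)
    fix u assume u: "u \<in> {..<9*s+7}"
    define x where "x = int (u + (9*s+8))"
    have e: "x - (9 * int s + 8) = int u" "x - 2 * int p = int u - (3 * int s + 2)"
      "x - (2 * int p + 1) = int u - (3 * int s + 3)"
      by (simp_all add: x_def p)
    have "0 \<le> x" "x < 3 * int p" using u p by (simp_all add: x_def)
    then have "partial_conv p 2 t (2 * x) = A (int u) - A (int u - (3 * int s + 2)) - A (int u - (3 * int s + 3))"
      using partial_conv_double[OF p t, of x] unfolding A_def[symmetric] e by (simp add: A0 x_def)
    then show "of_bool (partial_conv p 2 t (2 * int (u + (9*s+8))) \<noteq> 0) = ?g u" unfolding x_def by simp
  qed
  also have "\<dots> = (\<Sum>u<9*s+9. ?g u)"
    by (rule sum.mono_neutral_left) (auto simp: A0)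
  finally show ?thesis .
qed

text \<open>\<open>k\<close> and \<open>l\<close> count the indices \<open>\<le> t\<close> that are \<open>0\<close> and \<open>1\<close> modulo \<open>3\<close>.\<close>

lemma nonzero_count_blocks:
  fixes t k l :: nat
  assumes p: "p = 6 * s + 5" and t: "t \<le> p - 2"
    and k: "\<And>m. 3 * m \<le> t \<longleftrightarrow> m < k" and l: "\<And>m. 3 * m + 1 \<le> t \<longleftrightarrow> m < l"
  shows "nonzero_count p t =
    (\<Sum>m<3*s+3. of_bool ((m < k) \<noteq> (s + 1 \<le> m \<and> m < k + s + 1)))
  + (\<Sum>m<3*s+3. of_bool (- of_bool (m < l) + of_bool (m < k) + of_bool (s + 1 \<le> m \<and> m < l + s + 1) \<noteq> (0::int)))
  + (\<Sum>m<3*s+3. of_bool (m < l))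
  + (\<Sum>m<3*s+3. of_bool (of_bool (m < k) + of_bool (s + 1 \<le> m \<and> m < l + s + 1) - of_bool (s + 1 \<le> m \<and> m < k + s + 1) \<noteq> (0::int)))
  + (\<Sum>m<3*s+3. of_bool ((m < l) \<noteq> (s + 1 \<le> m \<and> m < l + s + 1)))
  + (\<Sum>m<3*s+3. of_bool (s \<le> m \<and> m < k + s))"
proof -
  define A where "A = trunc_coeff p t"
  have A0: "A (3 * y) = of_bool (0 \<le> y \<and> y < int k)" for y
  proof (cases "y \<ge> 0")
    case True
    then obtain m where "y = int m" using nonneg_int_cases by blast
    then show ?thesis using k[of m] t p by (auto simp: A_def trunc_coeff_def phi_coeff_def nat_mult_distrib)
  qed (auto simp: A_def trunc_coeff_def)
  have A1: "A (3 * y + 1) = - of_bool (0 \<le> y \<and> y < int l)" for y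
  proof (cases "y \<ge> 0")
    case True
    then obtain m where m: "y = int m" using nonneg_int_cases by blast
    have n: "nat (3 * int m + 1) = 3 * m + 1" by simp
    show ?thesis unfolding m A_def trunc_coeff_def n using l[of m] t p by (auto simp: phi_coeff_def mod_triple)
  qed (auto simp: A_def trunc_coeff_def)
  have A2: "A (3 * y + 2) = 0" for y
  proof (cases "y \<ge> 0")
    case True
    then obtain m where m: "y = int m" using nonneg_int_cases by blast
    have n: "nat (3 * int m + 2) = 3 * m + 2" by simp
    show ?thesis unfolding m A_def trunc_coeff_def n using t p by (auto simp: phi_coeff_def mod_triple)
  qed (auto simp: A_def trunc_coeff_def)
  let ?f = "\<lambda>i. A i + A (i - 1) - A (i - (3 * int s + 3))"
  let ?g = "\<lambda>i. A i - A (i - (3 * int s + 2)) - A (i - (3 * int s + 3))"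
  \<comment> \<open>Subtracting \<open>3 * s + 3\<close> keeps the residue modulo 3, subtracting 1
    lowers it and subtracting \<open>3 * s + 2\<close> raises it by one.\<close>
  have idx: "int (3 * m) = 3 * int m" "int (3 * m + 1) = 3 * int m + 1" "int (3 * m + 2) = 3 * int m + 2"
    "3 * int m - 1 = 3 * (int m - 1) + 2" "3 * int m + 1 - 1 = 3 * int m" "3 * int m + 2 - 1 = 3 * int m + 1"
    "3 * int m - (3 * int s + 3) = 3 * (int m - int s - 1)"
    "3 * int m + 1 - (3 * int s + 3) = 3 * (int m - int s - 1) + 1"
    "3 * int m + 2 - (3 * int s + 3) = 3 * (int m - int s - 1) + 2"
    "3 * int m - (3 * int s + 2) = 3 * (int m - int s - 1) + 1"
    "3 * int m + 1 - (3 * int s + 2) = 3 * (int m - int s - 1) + 2"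
    "3 * int m + 2 - (3 * int s + 2) = 3 * (int m - int s)" for m
    by simp_all
  have rng: "(0 \<le> int m \<and> int m < int x) = (m < x)"
    "(0 \<le> int m - int s - 1 \<and> int m - int s - 1 < int x) = (s + 1 \<le> m \<and> m < x + s + 1)"
    "(0 \<le> int m - int s \<and> int m - int s < int x) = (s \<le> m \<and> m < x + s)" for m x
    by auto
  have f: "?f (int (3 * m)) = of_bool (m < k) - of_bool (s + 1 \<le> m \<and> m < k + s + 1)"
    "?f (int (3 * m + 1)) = - of_bool (m < l) + of_bool (m < k) + of_bool (s + 1 \<le> m \<and> m < l + s + 1)"
    "?f (int (3 * m + 2)) = - of_bool (m < l)" for m
    unfolding idx A0 A1 A2 rng by simp_all
  have g: "?g (int (3 * m)) = of_bool (m < k) + of_bool (s + 1 \<le> m \<and> m < l + s + 1) - of_bool (s + 1 \<le> m \<and> m < k + s + 1)"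
    "?g (int (3 * m + 1)) = - of_bool (m < l) + of_bool (s + 1 \<le> m \<and> m < l + s + 1)"
    "?g (int (3 * m + 2)) = - of_bool (s \<le> m \<and> m < k + s)" for m
    unfolding idx A0 A1 A2 rng by simp_all
  have nz: "(of_bool P - of_bool Q \<noteq> (0::int)) = (P \<noteq> Q)" "(- of_bool P + of_bool Q \<noteq> (0::int)) = (P \<noteq> Q)"
    "(- of_bool P \<noteq> (0::int)) = P" for P Q
    by auto
  have nine: "9 * s + 9 = 3 * (3 * s + 3)" by simp
  show ?thesis
    unfolding nonzero_count_halves[OF p t] A_def[symmetric] nine sum_lessThan_triple f g nz sum.distrib
    by (simp only: add_ac)
qed

section \<open>Counting overlaps of intervals\<close>

lemma sum_of_bool_interval:
  "b \<le> n \<Longrightarrow> (\<Sum>m<n. of_bool (a \<le> m \<and> m < b)) = b - (a::nat)"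
proof -
  assume "b \<le> n"
  then have "{..<n} \<inter> {m. a \<le> m \<and> m < b} = {a..<b}" by auto
  then show ?thesis by (simp add: sum_of_bool_eq)
qed

lemma sum_of_bool_below: "b \<le> n \<Longrightarrow> (\<Sum>m<n. of_bool (m < b)) = (b::nat)"
  using sum_of_bool_interval[of b n 0] by simp

text \<open>For the interval below \<open>k\<close> and its translate by \<open>s + 1\<close>, both
  one-sided differences are intervals of length \<open>min k (s + 1)\<close>.\<close>

lemma sum_of_bool_xor:
  assumes "k \<le> 2 * s + 2"
  shows "(\<Sum>m<3*s+3. of_bool ((m < k) \<noteq> (s + 1 \<le> m \<and> m < k + s + 1))) = (2 * min k (s + 1) :: nat)"
proof -
  have "(\<Sum>m<3*s+3. of_bool ((m < k) \<noteq> (s + 1 \<le> m \<and> m < k + s + 1)) :: nat)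
    = (\<Sum>m<3*s+3. of_bool (m < min k (s + 1)) + of_bool (max k (s + 1) \<le> m \<and> m < k + s + 1))"
    by (intro sum.cong refl) auto
  also have "\<dots> = min k (s + 1) + (k + s + 1 - max k (s + 1))"
    unfolding sum.distrib using assms
    by (intro arg_cong2[where f = "(+)"] sum_of_bool_interval sum_of_bool_below) auto
  also have "\<dots> = 2 * min k (s + 1)"
    by (simp add: min_def max_def)
  finally show ?thesis .
qed

text \<open>Here \<open>k = l = a + 1\<close>, so opposite indicators cancel and each of the two
  mixed sums retains a single interval.\<close>

lemma nonzero_count_residue_nonzero:
  assumes p: "p = 6 * s + 5" and a: "a \<le> 2 * s" and b: "b = 1 \<or> b = 2"
  shows "nonzero_count p (3 * a + b) = 4 * (a + 1) + 4 * min (a + 1) (s + 1)"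
proof -
  have t: "3 * a + b \<le> p - 2" "3 * m \<le> 3 * a + b \<longleftrightarrow> m < a + 1" "3 * m + 1 \<le> 3 * a + b \<longleftrightarrow> m < a + 1" for m
    using p a b by auto
  have 1: "(- of_bool (m < a + 1) + of_bool (m < a + 1) + of_bool (s + 1 \<le> m \<and> m < a + 1 + s + 1) \<noteq> (0::int))
      = (s + 1 \<le> m \<and> m < a + 1 + s + 1)"
    "(of_bool (m < a + 1) + of_bool (s + 1 \<le> m \<and> m < a + 1 + s + 1) - of_bool (s + 1 \<le> m \<and> m < a + 1 + s + 1) \<noteq> (0::int))
      = (m < a + 1)" for m
    by simp_all
  have le: "a + 1 \<le> 2 * s + 2" "a + 1 + s + 1 \<le> 3 * s + 3" "a + 1 + s \<le> 3 * s + 3" "a + 1 \<le> 3 * s + 3"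
    using a by simp_all
  show ?thesis
    unfolding nonzero_count_blocks[OF p t] 1 sum_of_bool_interval[OF le(2)] sum_of_bool_interval[OF le(3)]
      sum_of_bool_below[OF le(4)] sum_of_bool_xor[OF le(1)]
    by simp
qed

text \<open>Here \<open>k = a + 1\<close> and \<open>l = a\<close>, so cancellation leaves an extra
  point in each mixed sum. The point \<open>m = a\<close> adds an entry only if
  \<open>a <= s\<close>; otherwise it lies in the translated interval and the value there is 2. The
  point \<open>m = a + s + 1\<close> always adds one.\<close>

lemma nonzero_count_residue_zero:
  assumes p: "p = 6 * s + 5" and a: "a \<le> 2 * s + 1"
  shows "nonzero_count p (3 * a) = 4 * a + 3 + 2 * min (a + 1) (s + 1) + 2 * min a (s + 1) + of_bool (a \<le> s)"
proof -
  have t: "3 * a \<le> p - 2" "3 * m \<le> 3 * a \<longleftrightarrow> m < a + 1" "3 * m + 1 \<le> 3 * a \<longleftrightarrow> m < a" for m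
    using p a by auto
  have 1: "of_bool (- of_bool (m < a) + of_bool (m < a + 1) + of_bool (s + 1 \<le> m \<and> m < a + s + 1) \<noteq> (0::int))
      = (of_bool (s + 1 \<le> m \<and> m < a + s + 1) + of_bool (a \<le> m \<and> m < a + of_bool (a \<le> s)) :: nat)" for m
    by (cases "a \<le> s"; cases "m < a"; cases "m = a") auto
  have 2: "of_bool (of_bool (m < a + 1) + of_bool (s + 1 \<le> m \<and> m < a + s + 1) - of_bool (s + 1 \<le> m \<and> m < a + 1 + s + 1) \<noteq> (0::int))
      = (of_bool (m < a + 1) + of_bool (a + s + 1 \<le> m \<and> m < a + s + 2) :: nat)" for m
    by (cases "m < a + 1"; cases "m < a + s + 1"; cases "m = a + s + 1") auto
  have le: "a + 1 \<le> 2 * s + 2" "a \<le> 2 * s + 2" "a + s + 1 \<le> 3 * s + 3" "a + s + 2 \<le> 3 * s + 3"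
    "a + 1 + s \<le> 3 * s + 3" "a + 1 \<le> 3 * s + 3" "a \<le> 3 * s + 3" "a + of_bool (a \<le> s) \<le> 3 * s + 3"
    using a by simp_all
  show ?thesis
    unfolding nonzero_count_blocks[OF p t] 1 2 sum.distrib sum_of_bool_interval[OF le(3)] sum_of_bool_interval[OF le(4)]
      sum_of_bool_interval[OF le(5)] sum_of_bool_interval[OF le(8)]
      sum_of_bool_below[OF le(6)] sum_of_bool_below[OF le(7)] sum_of_bool_xor[OF le(1)] sum_of_bool_xor[OF le(2)]
    by simp
qed

lemma sum_nonzero_count_half:
  assumes p: "p = 6 * s + 5"
  shows "(\<Sum>t<p-1. nonzero_count p t) = 42 * s ^ 2 + 75 * s + 33"
proof -
  have "p - 1 = Suc (3 * (2 * s + 1))" using p by simp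
  then have "(\<Sum>t<p-1. nonzero_count p t) = (\<Sum>t<3*(2*s+1). nonzero_count p t) + nonzero_count p (3 * (2 * s + 1))"
    by (simp only: sum.lessThan_Suc)
  also have "nonzero_count p (3 * (2 * s + 1)) = 12 * s + 11"
    using nonzero_count_residue_zero[OF p, of "2 * s + 1"] by simp
  also have "(\<Sum>t<3*(2*s+1). nonzero_count p t)
    = (\<Sum>a<2*s+1. if a \<le> s then 24 * a + 22 else 12 * a + 12 * s + 23)"
    unfolding sum_lessThan_triple
  proof (intro sum.cong refl)
    fix a assume "a \<in> {..<2*s+1}"
    then have "a \<le> 2 * s" by simp
    then show "nonzero_count p (3 * a) + nonzero_count p (3 * a + 1) + nonzero_count p (3 * a + 2)
        = (if a \<le> s then 24 * a + 22 else 12 * a + 12 * s + 23)"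
      using nonzero_count_residue_zero[OF p, of a] nonzero_count_residue_nonzero[OF p, of a 1]
        nonzero_count_residue_nonzero[OF p, of a 2] by auto
  qed
  \<comment> \<open>The minima are saturated at \<open>s + 1\<close> once \<open>a > s\<close>,
    hence the split.\<close>
  also have "\<dots> = (\<Sum>a<s+1. 24 * a + 22) + (\<Sum>i<s. 12 * (i + (s + 1)) + 12 * s + 23)"
  proof -
    have "2 * s + 1 = s + 1 + s" by simp
    then show ?thesis
      by (simp only: sum_lessThan_add) (intro arg_cong2[where f = "(+)"] sum.cong; simp)
  qed
  also have "(\<Sum>a<s+1. 24 * a + 22) = 12 * (s + 1) ^ 2 + 10 * (s + 1)"
  proof -
    have "(\<Sum>a<n. 24 * a + 22) = 12 * n ^ 2 + 10 * n" for n :: nat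
      by (induction n) (simp_all add: power2_eq_square)
    then show ?thesis by blast
  qed
  also have "(\<Sum>i<s. 12 * (i + (s + 1)) + 12 * s + 23) = 30 * s ^ 2 + 29 * s"
  proof -
    have "(\<Sum>i<n. 12 * (i + (s + 1)) + 12 * s + 23) = 6 * n ^ 2 + 24 * s * n + 29 * n" for n
      by (induction n) (simp_all add: power2_eq_square)
    then show ?thesis by (simp add: power2_eq_square)
  qed
  finally show ?thesis by (simp add: power2_eq_square)
qed

text \<open>Reflection carries the rows from \<open>p - 1\<close> to \<open>2 * p - 3\<close> onto
  the first \<open>p - 1\<close> rows. The total is
  \<open>3 * p * N = (p + 1) * (7 * p - 2) / 3\<close>.\<close>

lemma sum_nonzero_count:
  assumes p: "p = 6 * s + 5"
  shows "(\<Sum>t<2*p-2. nonzero_count p t) = 84 * s ^ 2 + 150 * s + 66"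
proof -
  have "2 * p - 2 = p - 1 + (p - 1)" by simp
  then have "(\<Sum>t<2*p-2. nonzero_count p t) = (\<Sum>t<p-1. nonzero_count p t) + (\<Sum>t<p-1. nonzero_count p (t + (p - 1)))"
    by (simp only: sum_lessThan_add)
  also have "(\<Sum>t<p-1. nonzero_count p (t + (p - 1))) = (\<Sum>t<p-1. nonzero_count p (2 * p - 3 - t))"
    unfolding sum.nat_diff_reindex[of "\<lambda>t. nonzero_count p (t + (p - 1))" "p - 1", symmetric]
    by (intro sum.cong arg_cong[where f = "nonzero_count p"] refl) (use p in auto)
  also have "\<dots> = (\<Sum>t<p-1. nonzero_count p t)"
    by (intro sum.cong refl nonzero_count_reflect[OF p]) (use p in auto)
  finally show ?thesis unfolding sum_nonzero_count_half[OF p] by simp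
qed

section \<open>The Hamming weight\<close>

text \<open>The coefficients are cut into rows of length \<open>q\<close>, on which
  \<open>m div q\<close> is constant. From row \<open>2 * p - 2\<close> on the convolution is
  complete and vanishes by \<open>full\<close>.\<close>

lemma hw_cyclotomic_poly:
  assumes p: "p = 6 * s + 5" and pr: "prime p" "prime q" "p \<noteq> q" "q \<noteq> 3"
    and full: "\<And>r. partial_conv p (int q) (2 * p - 2) r = 0"
  shows "hw (cyclotomic_poly (3 * p * q))
    = (\<Sum>t<2*p-2. \<Sum>u<q. of_bool (partial_conv p (int q) t (int (t * q) + int u) \<noteq> 0))"
proof -
  let ?P = "cyclotomic_poly (3 * p * q)"
  let ?c = "\<lambda>m. partial_conv p (int q) (m div q) (int m)"
  have q: "q > 0" using pr by (simp add: prime_gt_0_nat)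
  have "p mod 3 = 2" "p > 2" using p by (presburger, simp)
  then have "fps_of_poly ?P = phi_eval p (fps_X ^ q) * inv_fps p"
    using pr by (intro fps_cyclotomic_poly) auto
  then have "coeff ?P m = of_int (partial_conv p (int q) (min (m div q) (2 * p - 2)) (int m))" for m
    using fps_nth_phi_eval_mult[of q p m, where 'a = complex] q p by (metis fps_of_poly_nth prime_gt_0_nat pr(1))
  moreover have "partial_conv p (int q) (min (m div q) (2 * p - 2)) (int m) \<noteq> 0 \<longleftrightarrow> m < (2 * p - 2) * q \<and> ?c m \<noteq> 0" for m
  proof (cases "m < (2 * p - 2) * q")
    case True
    then have "m div q < 2 * p - 2" by (simp add: less_mult_imp_div_less)
    then show ?thesis using True by simp
  next
    case False
    then have "2 * p - 2 \<le> m div q" using q by (simp add: less_eq_div_iff_mult_less_eq)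
    then show ?thesis using full False by (simp add: min_absorb2)
  qed
  ultimately have "{m. coeff ?P m \<noteq> 0} = {..<(2 * p - 2) * q} \<inter> {m. ?c m \<noteq> 0}"
    by auto
  then have "hw ?P = (\<Sum>m<(2 * p - 2) * q. of_bool (?c m \<noteq> 0))"
    by (simp add: hw_def sum_of_bool_eq)
  also have "\<dots> = (\<Sum>t<2*p-2. \<Sum>m=t*q..<t*q+q. of_bool (?c m \<noteq> 0))"
    by (rule sum.nat_group[symmetric])
  also have "\<dots> = (\<Sum>t<2*p-2. \<Sum>u<q. of_bool (partial_conv p (int q) t (int (t * q) + int u) \<noteq> 0))"
  proof (rule sum.cong[OF refl])
    fix t
    have "(\<Sum>m=t*q..<t*q+q. of_bool (?c m \<noteq> 0)) = (\<Sum>u<q. of_bool (?c (u + t * q) \<noteq> 0) :: nat)"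
      by (rule sum.reindex_bij_witness[where i = "\<lambda>u. u + t * q" and j = "\<lambda>m. m - t * q"]) auto
    also have "\<dots> = (\<Sum>u<q. of_bool (partial_conv p (int q) t (int (t * q) + int u) \<noteq> 0))"
      by (intro sum.cong refl) (simp add: add.commute)
    finally show "(\<Sum>m=t*q..<t*q+q. of_bool (?c m \<noteq> 0))
        = (\<Sum>u<q. of_bool (partial_conv p (int q) t (int (t * q) + int u) \<noteq> 0) :: nat)" .
  qed
  finally show ?thesis .
qed

lemma partial_conv_diagonal:
  assumes p: "p = 6 * s + 5" and t: "t < 2 * p - 2"
  shows "of_bool (partial_conv p 2 t (int (2 * t)) \<noteq> 0) + of_bool (partial_conv p 2 t (int (2 * t + 1)) \<noteq> 0)
    = (of_bool (phi_coeff p (2 * t) \<noteq> 0) + of_bool (phi_coeff p (2 * t + 1) \<noteq> 0) :: nat)"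
  using partial_conv_two[OF p, of "2 * t"] partial_conv_two[OF p, of "2 * t + 1"] t by simp

lemma sum_partial_conv_diagonal:
  assumes p: "p = 6 * s + 5"
  shows "(\<Sum>t<2*p-2. of_bool (partial_conv p 2 t (int (2 * t)) \<noteq> 0) + of_bool (partial_conv p 2 t (int (2 * t + 1)) \<noteq> 0))
    = 8 * s + 7"
  using sum_phi_coeff_nonzero[OF p] partial_conv_diagonal[OF p] by (metis (no_types, lifting) lessThan_iff sum.cong)

lemma nonzero_count_periods:
  assumes "p > 0"
  shows "(\<Sum>u<k * (3 * p). of_bool (partial_conv p 2 t (int u + y) \<noteq> 0)) = k * nonzero_count p t"
  unfolding nonzero_count_def
  by (rule sum_periods[where f = "\<lambda>r. of_bool (partial_conv p 2 t r \<noteq> 0)"])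
    (use assms partial_conv_mod[of p 2 t] in auto)

text \<open>Row \<open>t\<close> starts at \<open>t * q\<close>, congruent to \<open>2 * t\<close>:
  two entries at \<open>2 * t\<close> and \<open>2 * t + 1\<close> precede \<open>k\<close> full
  periods.\<close>

lemma hw_remainder_two:
  assumes p: "p = 6 * s + 5" and pr: "prime p" "prime q" "p \<noteq> q" "q \<noteq> 3" and q: "q = k * (3 * p) + 2"
  shows "hw (cyclotomic_poly (3 * p * q)) = k * (84 * s ^ 2 + 150 * s + 66) + (8 * s + 7)"
proof -
  have iq: "int q = 2 + int k * (3 * int p)" using q by simp
  have mq: "int q mod (3 * int p) = 2 mod (3 * int p)" unfolding iq by (rule mod_mult_self1)
  have conv: "partial_conv p (int q) t r = partial_conv p 2 t r" for t r
    by (rule partial_conv_cong[OF mq refl])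
  have row: "(\<Sum>u<q. of_bool (partial_conv p 2 t (int (t * q) + int u) \<noteq> 0))
      = of_bool (partial_conv p 2 t (int (2 * t)) \<noteq> 0) + of_bool (partial_conv p 2 t (int (2 * t + 1)) \<noteq> 0)
        + k * nonzero_count p t" for t
  proof -
    let ?b = "\<lambda>r. of_bool (partial_conv p 2 t r \<noteq> 0) :: nat"
    have "?b (int (t * q) + int u) = ?b (int u + int (2 * t))" for u
    proof -
      have "int (t * q) + int u = int u + int (2 * t) + (int t * int k) * (3 * int p)"
        unfolding of_nat_mult iq by (simp add: algebra_simps)
      then have "(int (t * q) + int u) mod (3 * int p) = (int u + int (2 * t)) mod (3 * int p)"
        by (simp only: mod_mult_self1)
      then show ?thesis using partial_conv_cong[OF refl] by metis
    qed
    then have "(\<Sum>u<q. ?b (int (t * q) + int u)) = (\<Sum>u<2 + k * (3 * p). ?b (int u + int (2 * t)))"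
      using q by (simp add: add.commute)
    also have "\<dots> = (\<Sum>u<2. ?b (int u + int (2 * t))) + (\<Sum>u<k * (3 * p). ?b (int (u + 2) + int (2 * t)))"
      by (rule sum_lessThan_add)
    also have "(\<Sum>u<k * (3 * p). ?b (int (u + 2) + int (2 * t))) = (\<Sum>u<k * (3 * p). ?b (int u + int (2 * t + 2)))"
      by (simp add: algebra_simps)
    also have "\<dots> = k * nonzero_count p t"
      by (rule nonzero_count_periods) (use p in simp)
    finally show ?thesis by (simp add: eval_nat_numeral add.commute)
  qed
  have "hw (cyclotomic_poly (3 * p * q)) = (\<Sum>t<2*p-2. \<Sum>u<q. of_bool (partial_conv p 2 t (int (t * q) + int u) \<noteq> 0))"
    using hw_cyclotomic_poly[OF p pr] unfolding conv using partial_conv_full[OF p] by blast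
  also have "\<dots> = (8 * s + 7) + k * (84 * s ^ 2 + 150 * s + 66)"
    unfolding row
    by (simp only: sum.distrib[of _ "\<lambda>t. k * nonzero_count p t"] sum_distrib_left[symmetric] sum_nonzero_count[OF p]
        sum_partial_conv_diagonal[OF p])
  finally show ?thesis by simp
qed

text \<open>Each row is two entries short of \<open>k\<close> periods. The missing ones match the
  diagonal entries of row \<open>2 * p - 3 - t\<close>, and adding them over all rows gives
  \<open>8 * s + 7\<close>.\<close>

lemma hw_remainder_minus_two:
  assumes p: "p = 6 * s + 5" and pr: "prime p" "prime q" "p \<noteq> q" "q \<noteq> 3" and q: "q + 2 = k * (3 * p)"
  shows "hw (cyclotomic_poly (3 * p * q)) + (8 * s + 7) = k * (84 * s ^ 2 + 150 * s + 66)"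
proof -
  have iq: "int q = - 2 + int k * (3 * int p)"
    using arg_cong[OF q, of int] by simp
  have mq: "int q mod (3 * int p) = (- 2) mod (3 * int p)" unfolding iq by (rule mod_mult_self1)
  have p2: "p > 2" using p by simp
  have conv: "partial_conv p (int q) t r = - partial_conv p 2 t (int p + 2 - r)" for t r
    using partial_conv_cong[OF mq refl, of t r] partial_conv_uminus[OF p2, of 2 t r] by simp
  let ?e = "\<lambda>t. of_bool (partial_conv p 2 t (int (2 * t)) \<noteq> 0) + of_bool (partial_conv p 2 t (int (2 * t + 1)) \<noteq> 0) :: nat"
  have row: "(\<Sum>u<q. of_bool (partial_conv p (int q) t (int (t * q) + int u) \<noteq> 0)) + ?e (2 * p - 3 - t)
      = k * nonzero_count p t" if t: "t < 2 * p - 2" for t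
  proof -
    let ?b = "\<lambda>r. of_bool (partial_conv p 2 t r \<noteq> 0) :: nat"
    let ?t' = "2 * p - 3 - t"
    have tt: "t \<le> 2 * p - 3" using t by simp
    have mrow: "?b (int p + 2 - (int (t * q) + int u)) = ?b (int p + 2 + 2 * int t - int u)" for u
    proof -
      have "int p + 2 - (int (t * q) + int u) = int p + 2 + 2 * int t - int u + (- (int t * int k)) * (3 * int p)"
        unfolding of_nat_mult iq by (simp add: algebra_simps)
      then have "(int p + 2 - (int (t * q) + int u)) mod (3 * int p) = (int p + 2 + 2 * int t - int u) mod (3 * int p)"
        by (simp only: mod_mult_self1)
      then show ?thesis using partial_conv_cong[OF refl] by metis
    qed
    \<comment> \<open>As \<open>q\<close> is -2 modulo \<open>3 * p\<close>, the positions
      \<open>q\<close> and \<open>q + 1\<close> just past the row are reflected to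
      \<open>2 * ?t'\<close> and \<open>2 * ?t' + 1\<close>.\<close>
    have last: "?b (int p + 2 + 2 * int t - int (u + q)) = of_bool (partial_conv p 2 ?t' (int (2 * ?t' + u)) \<noteq> 0)" for u
    proof -
      have "5 * int p - 2 - (int p + 2 + 2 * int t - int (u + q)) = int (2 * ?t' + u) + int k * (3 * int p)"
        using t iq by (simp add: of_nat_diff algebra_simps)
      then have "(5 * int p - 2 - (int p + 2 + 2 * int t - int (u + q))) mod (3 * int p) = int (2 * ?t' + u) mod (3 * int p)"
        by (simp only: mod_mult_self1)
      then show ?thesis using partial_conv_cong[OF refl] partial_conv_reflect[OF p tt] by metis
    qed
    have "(\<Sum>u<q. of_bool (partial_conv p (int q) t (int (t * q) + int u) \<noteq> 0)) + ?e ?t'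
      = (\<Sum>u<q. ?b (int p + 2 + 2 * int t - int u)) + (\<Sum>u<2. ?b (int p + 2 + 2 * int t - int (u + q)))"
    proof -
      have "(\<Sum>u<2. f u) = f 0 + f 1" for f :: "nat \<Rightarrow> nat"
        by (simp add: eval_nat_numeral)
      then show ?thesis
        unfolding last conv neg_equal_0_iff_equal mrow by (simp only: add_0_right)
    qed
    also have "\<dots> = (\<Sum>u<q + 2. ?b (int p + 2 + 2 * int t - int u))"
      by (rule sum_lessThan_add[symmetric])
    also have "\<dots> = (\<Sum>u<q + 2. of_bool (partial_conv p 2 ?t' (int u + (4 * int p - 4 - 2 * int t)) \<noteq> 0))"
      unfolding partial_conv_reflect[OF p tt] by (simp add: algebra_simps)
    also have "\<dots> = k * nonzero_count p ?t'"
      unfolding q by (rule nonzero_count_periods) (use p in simp)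
    also have "\<dots> = k * nonzero_count p t"
      unfolding nonzero_count_reflect[OF p tt] ..
    finally show ?thesis .
  qed
  have "(\<Sum>t<2*p-2. ?e (2 * p - 3 - t)) = (\<Sum>t<2*p-2. ?e t)"
    by (rule sum.reindex_bij_witness[where i = "\<lambda>t. 2 * p - 3 - t" and j = "\<lambda>t. 2 * p - 3 - t"])
      (use p in auto)
  also have "\<dots> = 8 * s + 7" by (rule sum_partial_conv_diagonal[OF p])
  finally have e: "(\<Sum>t<2*p-2. ?e (2 * p - 3 - t)) = 8 * s + 7" .
  have "hw (cyclotomic_poly (3 * p * q)) = (\<Sum>t<2*p-2. \<Sum>u<q. of_bool (partial_conv p (int q) t (int (t * q) + int u) \<noteq> 0))"
    by (rule hw_cyclotomic_poly[OF p pr]) (simp add: conv partial_conv_full[OF p])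
  then have "hw (cyclotomic_poly (3 * p * q)) + (8 * s + 7)
     = (\<Sum>t<2*p-2. (\<Sum>u<q. of_bool (partial_conv p (int q) t (int (t * q) + int u) \<noteq> 0)) + ?e (2 * p - 3 - t))"
    unfolding sum.distrib[of _ "\<lambda>t. ?e (2 * p - 3 - t)"] e by simp
  also have "\<dots> = (\<Sum>t<2*p-2. k * nonzero_count p t)"
    by (intro sum.cong refl row) simp
  also have "\<dots> = k * (84 * s ^ 2 + 150 * s + 66)"
    by (simp only: sum_distrib_left[symmetric] sum_nonzero_count[OF p])
  finally show ?thesis .
qed

theorem theorem2p2:
  fixes p2 p3 r3 :: nat and N :: real
  assumes "prime p2" and "prime p3"
    and "3 < p2" and "p2 < p3"
    and "p2 mod 3 = 2"
    and "p3 > 3 * p2"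
    and "r3 = p3 mod (3 * p2)"
    and "N = (real p2 + 1) * (7 * real p2 - 2) / (9 * real p2)"
  shows "(r3 = 2 \<longrightarrow>
            real (hw (cyclotomic_poly (3 * p2 * p3)))
              = N * (real p3 - 2) + (4 * real p2 + 1) / 3) \<and>
         (r3 = 3 * p2 - 2 \<longrightarrow>
            real (hw (cyclotomic_poly (3 * p2 * p3)))
              = N * (real p3 + 2) - (4 * real p2 + 1) / 3)"
proof -
  have "odd p2" using assms(1,3) prime_odd_nat[of p2] by simp
  then have "p2 mod 6 = 5" using assms(5) by presburger
  then obtain s where p: "p2 = 6 * s + 5" by (metis mult_div_mod_eq)
  have ne: "p2 \<noteq> p3" "p3 \<noteq> 3" using assms(3,4) by auto
  define k where "k = p3 div (3 * p2)"
  have k: "p3 = k * (3 * p2) + r3" unfolding k_def assms(7) by (rule div_mult_mod_eq[symmetric])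
  \<comment> \<open>The total of \<open>sum_nonzero_count\<close>; as it equals
    \<open>3 * p2 * N\<close>, multiples of \<open>w\<close> turn into multiples of
    \<open>N\<close>.\<close>
  define w :: real where "w = 84 * real s ^ 2 + 150 * real s + 66"
  have N: "N * (3 * real p2) = w"
    unfolding assms(8) p w_def by (simp add: field_simps power2_eq_square)
  have E: "(4 * real p2 + 1) / 3 = 8 * real s + 7" unfolding p by simp
  show ?thesis
  proof (intro conjI impI)
    assume "r3 = 2"
    with k have q: "p3 = k * (3 * p2) + 2" by simp
    have "real (hw (cyclotomic_poly (3 * p2 * p3))) = real k * w + (8 * real s + 7)"
      unfolding hw_remainder_two[OF p assms(1,2) ne q] w_def by simp
    also have "real k * w = N * (real p3 - 2)"
      unfolding N[symmetric] q by simp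
    finally show "real (hw (cyclotomic_poly (3 * p2 * p3))) = N * (real p3 - 2) + (4 * real p2 + 1) / 3"
      unfolding E .
  next
    assume "r3 = 3 * p2 - 2"
    \<comment> \<open>Adding 2 completes one further period, hence \<open>Suc k\<close>.\<close>
    with k have q: "p3 + 2 = Suc k * (3 * p2)" using p by simp
    have "real (hw (cyclotomic_poly (3 * p2 * p3))) + (8 * real s + 7) = real (Suc k) * w"
      using arg_cong[OF hw_remainder_minus_two[OF p assms(1,2) ne q], of real] unfolding w_def by (simp add: algebra_simps)
    also have "\<dots> = N * (real p3 + 2)"
    proof -
      have "real p3 + 2 = real (Suc k) * (3 * real p2)"
        using arg_cong[OF q, of real] by (simp add: algebra_simps)
      then show ?thesis unfolding N[symmetric] by simp
    qed
    finally show "real (hw (cyclotomic_poly (3 * p2 * p3))) = N * (real p3 + 2) - (4 * real p2 + 1) / 3"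
      unfolding E by simp
  qed
qed

end
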